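(* Let $G$ be a graph and let $H$ be an attachment set of $G$, with $h=|H|$. Then: (i) if $h$ is even then $\eta(G)\le \eta(\mathfrak{a}(G,H))\le \eta(G)+2$; (ii) if $h$ is odd then $\eta(\mathfrak{a}(G,H))=\eta(G)$.
   Context: All graphs are finite and simple (not necessarily connected). The nullity $\eta(G)$ of a graph $G$ is $\dim\ker A(G)$, where $A(G)$ is the (real) adjacency matrix of $G$. An attachment set of $G$ is a cyclic $h$-tuple $H=(v_1,\dots,v_h)$ of vertices of $G$ with $h\ge 2$, in which a vertex may occur more than once; $|H|=h$ denotes the length of the tuple (counting repetitions). The altan $\mathfrak{a}(G,H)$ is the pair $(G',H')$, where $G'$ is the graph with vertex set $V(G')=V(G)\sqcup\{x_1,\dots,x_h\}\sqcup\{y_1,\dots,y_h\}$ (disjoint union, all $x_i$, $y_i$ being new distinct vertices) and edge set $E(G')=E(G)\sqcup\{v_ix_i,\,x_iy_i : 1\le i\le h\}\sqcup\{y_ix_{i+1} : 1\le i<h\}\sqcup\{y_hx_1\}$, and $H'=(y_1,\dots,y_h)$ is the induced attachment set. The nullity of a pair means the nullity of its graph, so $\eta(\mathfrak{a}(G,H))=\eta(G')$. *)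

theory Defs
  imports "Graph_Theory.Pair_Digraph" "Jordan_Normal_Form.Matrix_Kernel"
begin

text \<open>
  A finite simple graph is a \<open>pair_graph\<close>: a finite, loop-free digraph with a symmetric arc
  relation and no parallel arcs, so that an edge \<open>{u, v}\<close> is the pair of arcs
  \<open>(u, v)\<close> and \<open>(v, u)\<close>.
\<close>

definition adjacency_mat :: "'a pair_pre_digraph \<Rightarrow> 'a list \<Rightarrow> real mat" where
  "adjacency_mat G vs =
     mat (length vs) (length vs) (\<lambda>(i, j). if (vs ! i, vs ! j) \<in> parcs G then 1 else 0)"

text \<open>
  The rows and columns of a matrix are numbered, so the vertices have to be listed in some order.
  The lemma \<open>nullity_eq\<close> below shows that every order gives the same number.
\<close>

definition nullity :: "'a pair_pre_digraph \<Rightarrow> nat" where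
  "nullity G = kernel_dim (adjacency_mat G (SOME vs. distinct vs \<and> set vs = pverts G))"

text \<open>
  A cyclic tuple is represented by the list obtained by opening it at one of its entries.
\<close>

definition attachment_set :: "'a pair_pre_digraph \<Rightarrow> 'a list \<Rightarrow> bool" where
  "attachment_set G H \<longleftrightarrow> length H \<ge> 2 \<and> set H \<subseteq> pverts G"

datatype 'a altan_vertex = Old 'a | X nat | Y nat

text \<open>
  The new vertices are numbered from 0 to \<open>h - 1\<close>. The edges from \<open>Y i\<close> to \<open>X (i + 1)\<close> and
  the edge closing the cycle are covered together by \<open>Suc i mod h\<close>.
\<close>

definition altan ::
  "'a pair_pre_digraph \<Rightarrow> 'a list \<Rightarrow> 'a altan_vertex pair_pre_digraph \<times> 'a altan_vertex list" where
  "altan G H =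
    (let h = length H;
         E = (\<Union>i<h. {(Old (H ! i), X i), (X i, Y i), (Y i, X (Suc i mod h))})
     in (\<lparr> pverts = Old ` pverts G \<union> X ` {..<h} \<union> Y ` {..<h},
           parcs = map_prod Old Old ` parcs G \<union> E \<union> E\<inverse> \<rparr>,
         map Y [0..<h]))"

lemma kernel_dim_adjacency_mat_reorder:
  assumes "distinct vs" "distinct ws" "set vs = set ws"
  shows "kernel_dim (adjacency_mat G vs) = kernel_dim (adjacency_mat G ws)"
proof -
  define n where "n = length vs"
  have n: "length vs = n" "length ws = n"
    using distinct_card[OF assms(1)] distinct_card[OF assms(2)] assms(3) by (simp_all add: n_def)
  define P where "P = (mat n n (\<lambda>(i, j). if vs ! i = ws ! j then 1 else 0) :: real mat)"
  define Q where "Q = (mat n n (\<lambda>(i, j). if ws ! i = vs ! j then 1 else 0) :: real mat)"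
  have delta: "(\<Sum>k = 0..<n. f (us ! k) * (if us ! k = v then 1 else 0)) = f v"
    if "distinct us" "length us = n" "v \<in> set us" for f :: "'a \<Rightarrow> real" and us v
  proof -
    have "(\<Sum>k = 0..<n. f (us ! k) * (if us ! k = v then 1 else 0))
        = (\<Sum>u\<in>set us. f u * (if u = v then 1 else 0))"
      using that by (intro sum.reindex_bij_betw[of "(!) us"]) (metis atLeast0LessThan bij_betw_nth)
    also have "\<dots> = f v"
      using that by (simp add: if_distrib cong: if_cong)
    finally show ?thesis .
  qed
  have delta': "(\<Sum>k = 0..<n. (if v = us ! k then 1 else 0) * f (us ! k)) = f v"
    if "distinct us" "length us = n" "v \<in> set us" for f :: "'a \<Rightarrow> real" and us v
  proof -
    have "(if v = us ! k then 1 else 0) * f (us ! k) = f (us ! k) * (if us ! k = v then 1 else 0)" for k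
      by simp
    then show ?thesis using delta[OF that, of f] by presburger
  qed
  have mem: "vs ! i \<in> set ws" "ws ! i \<in> set vs" if "i < n" for i
    using that n assms(3) nth_mem by metis+
  have AP: "adjacency_mat G vs * P = mat n n (\<lambda>(i, j). if (vs ! i, ws ! j) \<in> parcs G then 1 else 0)"
  proof (rule eq_matI)
    fix i j
    assume "i < dim_row (mat n n (\<lambda>(i, j). if (vs ! i, ws ! j) \<in> parcs G then 1 else (0::real)))"
      and "j < dim_col (mat n n (\<lambda>(i, j). if (vs ! i, ws ! j) \<in> parcs G then 1 else (0::real)))"
    then show "(adjacency_mat G vs * P) $$ (i, j)
        = mat n n (\<lambda>(i, j). if (vs ! i, ws ! j) \<in> parcs G then 1 else 0) $$ (i, j)"
      using delta[OF assms(1) n(1) mem(2), of j "\<lambda>v. if (vs ! i, v) \<in> parcs G then 1 else 0"]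
      by (simp add: adjacency_mat_def P_def n scalar_prod_def)
  qed (simp_all add: adjacency_mat_def P_def n)
  have PA: "P * adjacency_mat G ws = mat n n (\<lambda>(i, j). if (vs ! i, ws ! j) \<in> parcs G then 1 else 0)"
  proof (rule eq_matI)
    fix i j
    assume "i < dim_row (mat n n (\<lambda>(i, j). if (vs ! i, ws ! j) \<in> parcs G then 1 else (0::real)))"
      and "j < dim_col (mat n n (\<lambda>(i, j). if (vs ! i, ws ! j) \<in> parcs G then 1 else (0::real)))"
    then show "(P * adjacency_mat G ws) $$ (i, j)
        = mat n n (\<lambda>(i, j). if (vs ! i, ws ! j) \<in> parcs G then 1 else 0) $$ (i, j)"
      using delta'[OF assms(2) n(2) mem(1), of i "\<lambda>v. if (v, ws ! j) \<in> parcs G then 1 else 0"]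
      by (simp add: adjacency_mat_def P_def n scalar_prod_def)
  qed (simp_all add: adjacency_mat_def P_def n)
  have PQ: "P * Q = 1\<^sub>m n"
  proof (rule eq_matI)
    fix i j assume "i < dim_row (1\<^sub>m n :: real mat)" "j < dim_col (1\<^sub>m n :: real mat)"
    then show "(P * Q) $$ (i, j) = (1\<^sub>m n :: real mat) $$ (i, j)"
      using delta'[OF assms(2) n(2) mem(1), of i "\<lambda>v. if v = vs ! j then 1 else 0"] assms(1)
      by (simp add: P_def Q_def n scalar_prod_def nth_eq_iff_index_eq)
  qed (simp_all add: P_def Q_def)
  have QP: "Q * P = 1\<^sub>m n"
  proof (rule eq_matI)
    fix i j assume "i < dim_row (1\<^sub>m n :: real mat)" "j < dim_col (1\<^sub>m n :: real mat)"
    then show "(Q * P) $$ (i, j) = (1\<^sub>m n :: real mat) $$ (i, j)"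
      using delta'[OF assms(1) n(1) mem(2), of i "\<lambda>v. if v = ws ! j then 1 else 0"] assms(2)
      by (simp add: P_def Q_def n scalar_prod_def nth_eq_iff_index_eq)
  qed (simp_all add: P_def Q_def)
  have carrier: "adjacency_mat G vs \<in> carrier_mat n n" "adjacency_mat G ws \<in> carrier_mat n n"
    "P \<in> carrier_mat n n" "Q \<in> carrier_mat n n"
    by (simp_all add: adjacency_mat_def P_def Q_def n)
  have "adjacency_mat G vs = adjacency_mat G vs * (P * Q)"
    using carrier by (simp add: PQ)
  also have "\<dots> = P * adjacency_mat G ws * Q"
    by (simp only: assoc_mult_mat[OF carrier(1,3,4), symmetric] AP PA)
  finally have "similar_mat_wit (adjacency_mat G vs) (adjacency_mat G ws) P Q"
    using carrier PQ QP by (simp add: similar_mat_wit_def Let_def)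
  from similar_mat_wit_kernel_dim[OF carrier(1) this] carrier
  show ?thesis
    by (simp add: kernel_dim_def)
qed

lemma nullity_eq:
  assumes "distinct vs" "set vs = pverts G"
  shows "nullity G = kernel_dim (adjacency_mat G vs)"
proof -
  have "distinct (SOME vs. distinct vs \<and> set vs = pverts G)
      \<and> set (SOME vs. distinct vs \<and> set vs = pverts G) = pverts G"
    by (rule someI[where x = vs]) (simp add: assms)
  then show ?thesis
    unfolding nullity_def using assms by (intro kernel_dim_adjacency_mat_reorder) auto
qed

lemma pair_graph_altan:
  fixes G :: "'a pair_pre_digraph" and H :: "'a list"
  assumes "pair_graph G" "attachment_set G H"
  shows "pair_graph (fst (altan G H))"
proof -
  interpret pair_graph G by fact
  define h where "h = length H"
  define E :: "('a altan_vertex \<times> 'a altan_vertex) set" where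
    "E = (\<Union>i<h. {(Old (H ! i), X i), (X i, Y i), (Y i, X (Suc i mod h))})"
  have V': "pverts (fst (altan G H)) = Old ` pverts G \<union> X ` {..<h} \<union> Y ` {..<h}"
    and A': "parcs (fst (altan G H)) = map_prod Old Old ` parcs G \<union> E \<union> E\<inverse>"
    by (simp_all add: altan_def Let_def h_def E_def)
  have h: "h \<ge> 2" and H: "\<And>i. i < h \<Longrightarrow> H ! i \<in> pverts G"
    using assms(2) by (auto simp: attachment_set_def h_def)
  have E: "E \<subseteq> pverts (fst (altan G H)) \<times> pverts (fst (altan G H))"
    using h H by (auto simp: V' E_def)
  have G: "map_prod Old Old ` parcs G \<subseteq> pverts (fst (altan G H)) \<times> pverts (fst (altan G H))"
    by (auto simp: V' dest: in_arcsD1 in_arcsD2)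
  have symG: "sym (parcs G)"
    using pair_sym_arcs by (simp add: symmetric_def)
  show ?thesis
  proof
    fix e assume "e \<in> parcs (fst (altan G H))"
    then show "fst e \<in> pverts (fst (altan G H))" "snd e \<in> pverts (fst (altan G H))"
      using E G by (auto simp: A')
    show "fst e \<noteq> snd e"
      using \<open>e \<in> parcs (fst (altan G H))\<close> pair_no_loops by (fastforce simp: A' E_def)
  next
    show "finite (pverts (fst (altan G H)))"
      by (simp add: V' pair_finite_verts)
    show "finite (parcs (fst (altan G H)))"
      by (simp add: A' E_def pair_finite_arcs)
    show "symmetric (with_proj (fst (altan G H)))"
    proof -
      have "sym (map_prod Old Old ` parcs G)"
        using symG by (auto simp: sym_def)
      then have "sym (parcs (fst (altan G H)))"
        unfolding A' Un_assoc by (intro sym_Un sym_Un_converse)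
      then show ?thesis by (simp add: symmetric_def)
    qed
  qed
qed

lemma attachment_set_altan:
  assumes "attachment_set G H"
  shows "attachment_set (fst (altan G H)) (snd (altan G H))"
  using assms by (auto simp: attachment_set_def altan_def Let_def)

end

theory Submission
  imports Defs
begin

text \<open>
  A kernel vector of the adjacency matrix is a function on the vertices whose values at the
  neighbours of each vertex add up to 0. On the altan \<open>G'\<close>, write such a function as a triple
  \<open>(u, a, b)\<close>: \<open>u\<close> on the old vertices, \<open>a\<close> on the \<open>X i\<close>, \<open>b\<close> on the \<open>Y i\<close>. With indices
  modulo \<open>h\<close>, the equations are (\<open>null_function_altan_iff\<close>)

  \<^item> at \<open>Y i\<close>: \<open>a (i + 1) = - a i\<close>, so \<open>a\<close> alternates around the cycle and is determined by \<open>a 0\<close>;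
    for odd \<open>h\<close> it must vanish;
  \<^item> at \<open>X (i + 1)\<close>: \<open>b (i + 1) = - b i - u (H ! (i + 1))\<close>, so \<open>b\<close> is determined by \<open>u\<close> and
    \<open>b 0\<close>. Going once around, the recursion closes up iff
    \<open>b 0 = (- 1) ^ h * (b 0 + s u)\<close>, where \<open>s u\<close> is the alternating sum of \<open>u\<close> along \<open>H\<close>. For odd
    \<open>h\<close> this fixes \<open>b 0 = - s u / 2\<close>; for even \<open>h\<close> it leaves \<open>b 0\<close> free and demands \<open>s u = 0\<close>;
  \<^item> at an old vertex: the equation of \<open>G\<close> for \<open>u\<close>, disturbed by values of \<open>a\<close>.

  For odd \<open>h\<close>, restriction to the old vertices is therefore a bijection between the null spaces.
  For even \<open>h\<close>, the two numbers \<open>a 0\<close> and \<open>b 0\<close> account for the upper bound, since a null function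
  with \<open>a 0 = b 0 = 0\<close> is determined by its restriction, which lies in the null space of \<open>G\<close>.
  For the lower bound, the condition \<open>s u = 0\<close> costs at most one dimension, and the free parameter
  \<open>b 0\<close> wins one back.

  Every inequality is obtained from a linear map between null spaces whose kernel is controlled
  (\<open>nullity_le_if_linear_inj\<close>). Where the natural map is defined only on the kernel of a functional
  (\<open>a 0 = 0\<close> or \<open>s u = 0\<close>), each null function is first moved into that kernel by subtracting
  a multiple of a fixed null function (\<open>ex_correcting_null_function\<close>).
\<close>

section \<open>Comparing kernel dimensions by linear maps\<close>

text \<open>
  An injective linear map takes a basis of its domain to an independent set.
\<close>

lemma kernel_dim_le_if_linear_inj:
  fixes A B :: "'f :: field mat"
  assumes A: "A \<in> carrier_mat nr nc" and B: "B \<in> carrier_mat nr' nc'"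
    and maps: "\<And>v. v \<in> mat_kernel A \<Longrightarrow> T v \<in> mat_kernel B"
    and add: "\<And>v w. v \<in> mat_kernel A \<Longrightarrow> w \<in> mat_kernel A \<Longrightarrow> T (v + w) = T v + T w"
    and smult: "\<And>c v. v \<in> mat_kernel A \<Longrightarrow> T (c \<cdot>\<^sub>v v) = c \<cdot>\<^sub>v T v"
    and zero: "\<And>v. v \<in> mat_kernel A \<Longrightarrow> T v = 0\<^sub>v nc' \<Longrightarrow> v = 0\<^sub>v nc"
  shows "kernel_dim A \<le> kernel_dim B"
proof -
  interpret KA: kernel nr nc A by (unfold_locales, rule A)
  interpret KB: kernel nr' nc' B by (unfold_locales, rule B)
  interpret T: linear_map class_ring KA.VK KB.VK T
    using maps add smult
    by unfold_locales (auto simp: module_hom_def)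
  obtain Bs where "finite Bs" and Bs: "KA.basis Bs"
    using kernel_basis_exists[OF A] by blast
  have Bs_sub: "Bs \<subseteq> mat_kernel A" and Bs_li: "KA.lin_indpt Bs"
    using Bs unfolding KA.Ker.basis_def by auto
  obtain Cs where "finite Cs" "KB.basis Cs"
    using kernel_basis_exists[OF B] by blast
  then have fin: "KB.Ker.fin_dim"
    unfolding KB.Ker.fin_dim_def KB.Ker.basis_def by blast
  have "v = w" if "v \<in> mat_kernel A" "w \<in> mat_kernel A" "T v = T w" for v w
  proof -
    have c: "v \<in> carrier_vec nc" "w \<in> carrier_vec nc" "T w \<in> carrier_vec nc'"
      using that mat_kernelD(1)[OF A] mat_kernelD(1)[OF B] maps by blast+
    have m: "(- 1) \<cdot>\<^sub>v w \<in> mat_kernel A"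
      by (rule mat_kernel_smult[OF A that(2)])
    have s: "v + (- 1) \<cdot>\<^sub>v w \<in> mat_kernel A"
      using KA.Ker.M.a_closed[OF that(1) m] by simp
    have "T (v + (- 1) \<cdot>\<^sub>v w) = 0\<^sub>v nc'"
      using add[OF that(1) m] smult[OF that(2), of "- 1"] that(3) c by auto
    then have "v + (- 1) \<cdot>\<^sub>v w = 0\<^sub>v nc"
      by (rule zero[OF s])
    then have "(v + (- 1) \<cdot>\<^sub>v w) $ i = 0" if "i < nc" for i
      using that by simp
    then have "v $ i = w $ i" if "i < nc" for i
      using that c by simp
    then show "v = w" using c by (intro eq_vecI) auto
  qed
  then have inj: "inj_on T (mat_kernel A)"
    by (auto simp: inj_on_def)
  have TBs_sub: "T ` Bs \<subseteq> mat_kernel B"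
    using maps Bs_sub by blast
  have "KB.lin_indpt (T ` Bs)"
  proof (rule KB.Ker.finite_lin_indpt2)
    fix a assume "KB.lincomb a (T ` Bs) = 0\<^sub>v nc'"
    then have "T (KA.lincomb (a \<circ> T) Bs) = 0\<^sub>v nc'"
      using T.lincomb_linear_image[of Bs a] inj Bs_sub \<open>finite Bs\<close> by simp
    moreover have "KA.lincomb (a \<circ> T) Bs \<in> mat_kernel A"
      using KA.Ker.lincomb_closed[OF Bs_sub] by simp
    ultimately have "KA.lincomb (a \<circ> T) Bs = 0\<^sub>v nc"
      by (rule zero[rotated])
    then have "a \<circ> T \<in> Bs \<rightarrow> {0}"
      by (intro KA.Ker.not_lindepD[OF Bs_li \<open>finite Bs\<close>]) auto
    then show "\<forall>v \<in> T ` Bs. a v = 0" by auto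
  qed (use \<open>finite Bs\<close> TBs_sub in auto)
  then have "card (T ` Bs) \<le> KB.dim"
    using KB.Ker.li_le_dim(2)[OF fin] TBs_sub by simp
  moreover have "card (T ` Bs) = KA.dim"
    using card_image[OF inj_on_subset[OF inj Bs_sub]] KA.Ker.dim_basis[OF \<open>finite Bs\<close> Bs] by simp
  ultimately show ?thesis by simp
qed

lemma kernel_dim_zero_mat: "kernel_dim (0\<^sub>m n n :: 'f :: field mat) = n"
proof -
  interpret kernel n n "0\<^sub>m n n :: 'f mat" by unfold_locales simp
  have "pivot_fun (0\<^sub>m n n :: 'f mat) (\<lambda>_. n) n"
    by (rule pivot_funI) auto
  then have "row_echelon_form (0\<^sub>m n n :: 'f mat)"
    unfolding row_echelon_form_def by auto
  then have "dim = n - card {i. i < n \<and> row (0\<^sub>m n n :: 'f mat) i \<noteq> 0\<^sub>v n}"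
    by (rule find_base_vectors) simp
  moreover have "{i. i < n \<and> row (0\<^sub>m n n :: 'f mat) i \<noteq> 0\<^sub>v n} = {}" by auto
  ultimately show ?thesis by simp
qed

section \<open>Null functions of a graph\<close>

text \<open>
  Linearity of maps between function spaces on arbitrary types, which need not be finite. A family
  of functionals indexed by \<open>nat\<close> is the case \<open>'b = nat\<close>.
\<close>

definition linear_op :: "(('a \<Rightarrow> real) \<Rightarrow> ('b \<Rightarrow> real)) \<Rightarrow> bool" where
  "linear_op T \<longleftrightarrow> (\<forall>f g c. T (\<lambda>x. f x + c * g x) = (\<lambda>y. T f y + c * T g y))"

lemma linear_opD:
  assumes "linear_op T"
  shows "T (\<lambda>x. f x + c * g x) = (\<lambda>y. T f y + c * T g y)"
  using assms[unfolded linear_op_def, rule_format, of f c g] .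

lemma linear_op_scale:
  assumes "linear_op T"
  shows "T (\<lambda>x. c * f x) = (\<lambda>y. c * T f y)"
  using linear_opD[OF assms, of f "c - 1" f] by (simp add: algebra_simps)

text \<open>
  The elements of the kernel of the adjacency matrix, described without an enumeration of the
  vertices. Values outside \<open>pverts G\<close> are arbitrary.
\<close>

definition null_function :: "'a pair_pre_digraph \<Rightarrow> ('a \<Rightarrow> real) \<Rightarrow> bool" where
  "null_function G f \<longleftrightarrow> (\<forall>v \<in> pverts G. (\<Sum>w | w \<in> pverts G \<and> (v, w) \<in> parcs G. f w) = 0)"

text \<open>
  Extends a coordinate vector by 0 outside the listed vertices; as a sum, it is visibly linear
  in \<open>v\<close>.
\<close>

definition function_of_vec :: "'a list \<Rightarrow> real vec \<Rightarrow> 'a \<Rightarrow> real" where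
  "function_of_vec vs v x = (\<Sum>i<length vs. if vs ! i = x then v $ i else 0)"

lemma function_of_vec_nth:
  assumes "distinct vs" "i < length vs"
  shows "function_of_vec vs v (vs ! i) = v $ i"
proof -
  have "function_of_vec vs v (vs ! i) = (\<Sum>j<length vs. if j = i then v $ j else 0)"
    unfolding function_of_vec_def using assms
    by (intro sum.cong) (auto simp: nth_eq_iff_index_eq)
  also have "\<dots> = v $ i" using assms(2) by simp
  finally show ?thesis .
qed

lemma sum_neighbours_nth:
  assumes "distinct vs" "set vs = pverts G"
  shows "(\<Sum>w | w \<in> pverts G \<and> (u, w) \<in> parcs G. f w)
    = (\<Sum>j<length vs. if (u, vs ! j) \<in> parcs G then f (vs ! j) else 0)"
proof -
  have "(\<Sum>w | w \<in> pverts G \<and> (u, w) \<in> parcs G. f w) = (\<Sum>w\<in>set vs. if (u, w) \<in> parcs G then f w else 0)"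
    using assms(2)[symmetric] by (simp add: sum.inter_filter[symmetric])
  also have "\<dots> = (\<Sum>j<length vs. if (u, vs ! j) \<in> parcs G then f (vs ! j) else 0)"
    using assms(1) by (intro sum.reindex_bij_betw[symmetric] bij_betw_nth) auto
  finally show ?thesis .
qed

lemma mat_kernel_adjacency_iff:
  assumes "distinct vs" "set vs = pverts G" "dim_vec v = length vs"
    and f: "\<And>i. i < length vs \<Longrightarrow> f (vs ! i) = v $ i"
  shows "v \<in> mat_kernel (adjacency_mat G vs) \<longleftrightarrow> null_function G f"
proof -
  let ?A = "adjacency_mat G vs"
  have A: "?A \<in> carrier_mat (length vs) (length vs)"
    by (simp add: adjacency_mat_def)
  have v: "v \<in> carrier_vec (length vs)"
    by (rule carrier_vecI) (fact assms(3))
  have row: "(?A *\<^sub>v v) $ i = (\<Sum>w | w \<in> pverts G \<and> (vs ! i, w) \<in> parcs G. f w)"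
    if "i < length vs" for i
  proof -
    have "(?A *\<^sub>v v) $ i = (\<Sum>j<length vs. ?A $$ (i, j) * v $ j)"
      using that A v by (simp add: scalar_prod_def atLeast0LessThan)
    also have "\<dots> = (\<Sum>j<length vs. if (vs ! i, vs ! j) \<in> parcs G then f (vs ! j) else 0)"
      using that by (intro sum.cong refl) (simp add: adjacency_mat_def f)
    also have "\<dots> = (\<Sum>w | w \<in> pverts G \<and> (vs ! i, w) \<in> parcs G. f w)"
      by (rule sum_neighbours_nth[OF assms(1,2), symmetric])
    finally show ?thesis .
  qed
  have "v \<in> mat_kernel ?A \<longleftrightarrow> ?A *\<^sub>v v = 0\<^sub>v (length vs)"
    using v by (simp add: mat_kernel[OF A])
  also have "\<dots> \<longleftrightarrow> (\<forall>i < length vs. (?A *\<^sub>v v) $ i = 0)"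
  proof
    assume "\<forall>i < length vs. (?A *\<^sub>v v) $ i = 0"
    then show "?A *\<^sub>v v = 0\<^sub>v (length vs)"
      using A by (intro eq_vecI) auto
  qed simp
  also have "\<dots> \<longleftrightarrow> null_function G f"
    unfolding null_function_def assms(2)[symmetric] all_set_conv_all_nth using row assms(2) by simp
  finally show ?thesis .
qed

lemma function_of_vec_add:
  assumes "dim_vec v = length vs" "dim_vec w = length vs"
  shows "function_of_vec vs (v + w) = (\<lambda>x. function_of_vec vs v x + function_of_vec vs w x)"
  unfolding function_of_vec_def sum.distrib[symmetric]
  by (intro ext sum.cong refl) (simp add: assms)

lemma function_of_vec_smult:
  assumes "dim_vec v = length vs"
  shows "function_of_vec vs (c \<cdot>\<^sub>v v) = (\<lambda>x. c * function_of_vec vs v x)"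
  unfolding function_of_vec_def sum_distrib_left
  by (intro ext sum.cong refl) (simp add: assms)

text \<open>
  The form in which dimensions are compared below: \<open>(T, l)\<close> embeds the null space of \<open>G\<close> into the
  product of that of \<open>G'\<close> with \<open>k\<close>-dimensional space. This product is the kernel of the adjacency
  matrix of \<open>G'\<close> bordered by \<open>k\<close> zero rows and columns, as if \<open>k\<close> isolated vertices were added.
\<close>

lemma nullity_le_if_linear_inj:
  fixes G :: "'a pair_pre_digraph" and G' :: "'b pair_pre_digraph"
    and l :: "('a \<Rightarrow> real) \<Rightarrow> nat \<Rightarrow> real"
  assumes "finite (pverts G)" "finite (pverts G')"
    and T: "linear_op T" and l: "linear_op l"
    and maps: "\<And>f. null_function G f \<Longrightarrow> null_function G' (T f)"
    and inj: "\<And>f. null_function G f \<Longrightarrow> \<forall>y \<in> pverts G'. T f y = 0 \<Longrightarrow> \<forall>i<k. l f i = 0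
       \<Longrightarrow> \<forall>x \<in> pverts G. f x = 0"
  shows "nullity G \<le> nullity G' + k"
proof -
  obtain vs where vs: "distinct vs" "set vs = pverts G"
    using finite_distinct_list[OF assms(1)] by blast
  obtain ws where ws: "distinct ws" "set ws = pverts G'"
    using finite_distinct_list[OF assms(2)] by blast
  define n m where "n = length vs" and "m = length ws"
  define A where "A = adjacency_mat G vs"
  define B where "B = four_block_mat (adjacency_mat G' ws) (0\<^sub>m m k) (0\<^sub>m k m) (0\<^sub>m k k)"
  define \<Phi> where "\<Phi> v = vec m (\<lambda>j. T (function_of_vec vs v) (ws ! j))
                      @\<^sub>v vec k (l (function_of_vec vs v))" for v
  have A: "A \<in> carrier_mat n n" and G': "adjacency_mat G' ws \<in> carrier_mat m m"
    by (simp_all add: A_def adjacency_mat_def n_def m_def)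
  then have B: "B \<in> carrier_mat (m + k) (m + k)" by (simp add: B_def)
  have kernel_A: "dim_vec v = n" "null_function G (function_of_vec vs v)" if "v \<in> mat_kernel A" for v
    using that mat_kernelD(1)[OF A] mat_kernel_adjacency_iff[OF vs, of v "function_of_vec vs v"]
    by (auto simp: A_def n_def function_of_vec_nth[OF vs(1)])
  have "kernel_dim A \<le> kernel_dim B"
  proof (rule kernel_dim_le_if_linear_inj[OF A B, of \<Phi>])
    fix v assume v: "v \<in> mat_kernel A"
    let ?a = "vec m (\<lambda>j. T (function_of_vec vs v) (ws ! j))"
    let ?b = "vec k (l (function_of_vec vs v))"
    have "?a \<in> mat_kernel (adjacency_mat G' ws)"
      using mat_kernel_adjacency_iff[OF ws, of ?a "T (function_of_vec vs v)"]
        maps[OF kernel_A(2)[OF v]] by (simp add: m_def)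
    then have "adjacency_mat G' ws *\<^sub>v ?a = 0\<^sub>v m"
      by (rule mat_kernelD(2)[OF G'])
    then have "B *\<^sub>v \<Phi> v = 0\<^sub>v (m + k)"
      unfolding B_def \<Phi>_def using G' by (subst mult_mat_vec_split) auto
    then show "\<Phi> v \<in> mat_kernel B"
      using B by (intro mat_kernelI) (auto simp: \<Phi>_def)
    fix w assume w: "w \<in> mat_kernel A"
    let ?f = "function_of_vec vs v" and ?g = "function_of_vec vs w"
    have "function_of_vec vs (v + w) = (\<lambda>x. ?f x + 1 * ?g x)"
      using kernel_A(1)[OF v] kernel_A(1)[OF w]
      by (simp add: function_of_vec_add n_def)
    moreover have "T (\<lambda>x. ?f x + 1 * ?g x) = (\<lambda>y. T ?f y + 1 * T ?g y)"
      "l (\<lambda>x. ?f x + 1 * ?g x) = (\<lambda>y. l ?f y + 1 * l ?g y)"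
      by (rule linear_opD[OF T] linear_opD[OF l])+
    ultimately show "\<Phi> (v + w) = \<Phi> v + \<Phi> w"
      unfolding \<Phi>_def by (auto intro!: eq_vecI)
  next
    fix c v assume v: "v \<in> mat_kernel A"
    have "function_of_vec vs (c \<cdot>\<^sub>v v) = (\<lambda>x. c * function_of_vec vs v x)"
      using kernel_A(1)[OF v] by (simp add: function_of_vec_smult n_def)
    then show "\<Phi> (c \<cdot>\<^sub>v v) = c \<cdot>\<^sub>v \<Phi> v"
      unfolding \<Phi>_def by (auto simp: linear_op_scale[OF T] linear_op_scale[OF l] intro!: eq_vecI)
  next
    fix v assume v: "v \<in> mat_kernel A" and 0: "\<Phi> v = 0\<^sub>v (m + k)"
    have T0: "T (function_of_vec vs v) (ws ! j) = 0" if "j < m" for j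
      using that arg_cong[OF 0, of "\<lambda>v. v $ j"] by (simp add: \<Phi>_def)
    have l0: "l (function_of_vec vs v) i = 0" if "i < k" for i
      using that arg_cong[OF 0, of "\<lambda>v. v $ (m + i)"] by (simp add: \<Phi>_def)
    have "\<forall>x \<in> pverts G. function_of_vec vs v x = 0"
    proof (rule inj[OF kernel_A(2)[OF v]])
      show "\<forall>y\<in>pverts G'. T (function_of_vec vs v) y = 0"
        using T0 by (auto simp: ws(2)[symmetric] in_set_conv_nth m_def)
    qed (use l0 in simp)
    then have "v $ i = 0" if "i < n" for i
      using that function_of_vec_nth[OF vs(1)] vs(2) nth_mem unfolding n_def by metis
    then show "v = 0\<^sub>v n"
      using kernel_A(1)[OF v] by (intro eq_vecI) auto
  qed
  moreover have "kernel_dim B = kernel_dim (adjacency_mat G' ws) + k"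
    using kernel_four_block_0_mat[OF B_def G' zero_carrier_mat] kernel_dim_zero_mat[of k, where 'f = real] B G'
    by (simp add: kernel_dim_def)
  ultimately show ?thesis
    using nullity_eq[OF vs] nullity_eq[OF ws] by (simp add: A_def)
qed

lemma null_function_linear:
  assumes "null_function G f" "null_function G g"
  shows "null_function G (\<lambda>x. f x + c * g x)"
  using assms by (simp add: null_function_def sum.distrib sum_distrib_left[symmetric])

text \<open>
  For linear \<open>s\<close>, the map \<open>u \<mapsto> u - s u / s u\<^sub>0 * u\<^sub>0\<close> is then a linear way of moving null functions
  into the kernel of \<open>s\<close>. If \<open>s\<close> vanishes on the null space, nothing has to be moved and
  \<open>u\<^sub>0 = 0\<close> will do.
\<close>

lemma ex_correcting_null_function:
  fixes s :: "('a \<Rightarrow> real) \<Rightarrow> real"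
  obtains u\<^sub>0 where "null_function G u\<^sub>0"
    and "\<And>u. null_function G u \<Longrightarrow> s u - s u / s u\<^sub>0 * s u\<^sub>0 = 0"
proof (cases "\<exists>u\<^sub>0. null_function G u\<^sub>0 \<and> s u\<^sub>0 \<noteq> 0")
  case True
  then show ?thesis using that by auto
next
  case False
  moreover have "null_function G (\<lambda>_. 0)" by (simp add: null_function_def)
  ultimately show ?thesis using that[of "\<lambda>_. 0"] by simp
qed

section \<open>The null functions of the altan\<close>

locale altan_pair =
  fixes G :: "'a pair_pre_digraph" and H :: "'a list" and h :: nat
    and G' :: "'a altan_vertex pair_pre_digraph"
  defines "h \<equiv> length H" and "G' \<equiv> fst (altan G H)"
  assumes graph: "pair_graph G" and attachment: "attachment_set G H"
begin

definition next_pos :: "nat \<Rightarrow> nat" where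
  "next_pos i = Suc i mod h"

lemma h_ge_2: "h \<ge> 2" and H_in: "i < h \<Longrightarrow> H ! i \<in> pverts G"
  using attachment by (auto simp: attachment_set_def h_def)

lemma finite_pverts: "finite (pverts G)"
proof -
  interpret pair_graph G by (rule graph)
  show ?thesis by (rule pair_finite_verts)
qed

lemma pverts_altan: "pverts G' = Old ` pverts G \<union> X ` {..<h} \<union> Y ` {..<h}"
  by (simp add: G'_def altan_def Let_def h_def)

lemma finite_pverts_altan: "finite (pverts G')"
  by (simp add: pverts_altan finite_pverts)

lemma next_pos_less: "next_pos i < h"
  using h_ge_2 by (simp add: next_pos_def)

lemma next_pos_last: "next_pos (h - Suc 0) = 0"
  using h_ge_2 by (simp add: next_pos_def)

lemma next_pos_Suc: "Suc i < h \<Longrightarrow> next_pos i = Suc i"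
  by (simp add: next_pos_def)

lemma next_pos_eq_iff: "i < h \<Longrightarrow> j < h \<Longrightarrow> next_pos i = next_pos j \<longleftrightarrow> i = j"
  by (auto simp: next_pos_def mod_Suc split: if_splits)

lemma next_pos_neq: "i < h \<Longrightarrow> next_pos i \<noteq> i"
  using h_ge_2 by (auto simp: next_pos_def mod_Suc split: if_splits)

lemma less_h_cases:
  assumes "j < h"
  obtains i where "i < h" "j = next_pos i"
proof (cases j)
  case 0
  then show ?thesis using that[of "h - 1"] h_ge_2 by (simp add: next_pos_last)
next
  case (Suc i)
  then show ?thesis using that[of i] assms by (simp add: next_pos_Suc)
qed

lemma parcs_altan:
  "(p, q) \<in> parcs G' \<longleftrightarrow> (case (p, q) of
     (Old v, Old w) \<Rightarrow> (v, w) \<in> parcs G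
   | (Old v, X i) \<Rightarrow> i < h \<and> v = H ! i
   | (X i, Old v) \<Rightarrow> i < h \<and> v = H ! i
   | (X i, Y j) \<Rightarrow> i < h \<and> j < h \<and> (i = j \<or> i = next_pos j)
   | (Y j, X i) \<Rightarrow> i < h \<and> j < h \<and> (i = j \<or> i = next_pos j)
   | _ \<Rightarrow> False)"
  using next_pos_less
  by (cases p; cases q)
    (auto simp: G'_def altan_def Let_def h_def next_pos_def map_prod_def image_iff split: prod.splits)

lemma neighbours_Old:
  "{q \<in> pverts G'. (Old v, q) \<in> parcs G'} =
    Old ` {w \<in> pverts G. (v, w) \<in> parcs G} \<union> X ` {i. i < h \<and> H ! i = v}"
  by (auto simp: pverts_altan parcs_altan)

lemma neighbours_X:
  assumes "i < h"
  shows "{q \<in> pverts G'. (X (next_pos i), q) \<in> parcs G'} = {Old (H ! next_pos i), Y (next_pos i), Y i}"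
proof (rule Set.set_eqI)
  fix q
  show "q \<in> {q \<in> pverts G'. (X (next_pos i), q) \<in> parcs G'} \<longleftrightarrow> q \<in> {Old (H ! next_pos i), Y (next_pos i), Y i}"
    using assms next_pos_less[of i] H_in[OF next_pos_less[of i]]
    by (cases q) (auto simp: pverts_altan parcs_altan next_pos_eq_iff)
qed

lemma neighbours_Y:
  assumes "i < h"
  shows "{q \<in> pverts G'. (Y i, q) \<in> parcs G'} = {X i, X (next_pos i)}"
proof (rule Set.set_eqI)
  fix q
  show "q \<in> {q \<in> pverts G'. (Y i, q) \<in> parcs G'} \<longleftrightarrow> q \<in> {X i, X (next_pos i)}"
    using assms next_pos_less[of i] by (cases q) (auto simp: pverts_altan parcs_altan)
qed

text \<open>
  The equations at the old vertices, at \<open>Y i\<close> and at \<open>X (i + 1)\<close>. Indexing the last family by the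
  successor turns it into a recursion along the \<open>Y i\<close>; this loses no equation, as every index is a
  successor.
\<close>

lemma null_function_altan_iff:
  "null_function G' f \<longleftrightarrow>
     (\<forall>v \<in> pverts G. (\<Sum>w | w \<in> pverts G \<and> (v, w) \<in> parcs G. f (Old w)) +
        (\<Sum>i | i < h \<and> H ! i = v. f (X i)) = 0) \<and>
     (\<forall>i<h. f (X (next_pos i)) = - f (X i)) \<and>
     (\<forall>i<h. f (Y (next_pos i)) = - f (Y i) - f (Old (H ! next_pos i)))"
proof -
  have Old: "(\<Sum>q | q \<in> pverts G' \<and> (Old v, q) \<in> parcs G'. f q) =
    (\<Sum>w | w \<in> pverts G \<and> (v, w) \<in> parcs G. f (Old w)) + (\<Sum>i | i < h \<and> H ! i = v. f (X i))" for v
    unfolding neighbours_Old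
    by (subst sum.union_disjoint) (auto simp: finite_pverts sum.reindex inj_on_def)
  have X: "(\<Sum>q | q \<in> pverts G' \<and> (X (next_pos i), q) \<in> parcs G'. f q) = 0
    \<longleftrightarrow> f (Y (next_pos i)) = - f (Y i) - f (Old (H ! next_pos i))" if "i < h" for i
  proof -
    have "(\<Sum>q | q \<in> pverts G' \<and> (X (next_pos i), q) \<in> parcs G'. f q) =
      f (Old (H ! next_pos i)) + f (Y (next_pos i)) + f (Y i)"
      using next_pos_neq[OF that] by (simp add: neighbours_X[OF that])
    then show ?thesis by linarith
  qed
  have Y: "(\<Sum>q | q \<in> pverts G' \<and> (Y i, q) \<in> parcs G'. f q) = 0
    \<longleftrightarrow> f (X (next_pos i)) = - f (X i)" if "i < h" for i
  proof -
    have "(\<Sum>q | q \<in> pverts G' \<and> (Y i, q) \<in> parcs G'. f q) = f (X i) + f (X (next_pos i))"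
      using next_pos_neq[OF that] by (simp add: neighbours_Y[OF that])
    then show ?thesis by linarith
  qed
  have all_next_pos: "(\<forall>i<h. P i) \<longleftrightarrow> (\<forall>i<h. P (next_pos i))" for P
    using next_pos_less less_h_cases by metis
  have "null_function G' f \<longleftrightarrow>
     (\<forall>v \<in> pverts G. (\<Sum>q | q \<in> pverts G' \<and> (Old v, q) \<in> parcs G'. f q) = 0) \<and>
     (\<forall>i<h. (\<Sum>q | q \<in> pverts G' \<and> (Y i, q) \<in> parcs G'. f q) = 0) \<and>
     (\<forall>i<h. (\<Sum>q | q \<in> pverts G' \<and> (X i, q) \<in> parcs G'. f q) = 0)"
  proof -
    have "(\<forall>p \<in> pverts G'. P p) \<longleftrightarrow>
      (\<forall>v \<in> pverts G. P (Old v)) \<and> (\<forall>i<h. P (Y i)) \<and> (\<forall>i<h. P (X i))" for P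
      unfolding pverts_altan by blast
    then show ?thesis unfolding null_function_def .
  qed
  then show ?thesis
    unfolding all_next_pos[of "\<lambda>i. (\<Sum>q | q \<in> pverts G' \<and> (X i, q) \<in> parcs G'. f q) = 0"]
    by (simp add: Old X Y)
qed

text \<open>
  The indices are shifted by one: term \<open>j\<close> comes from the equation at \<open>X (j + 1)\<close>, which governs
  the step from \<open>Y j\<close> to \<open>Y (j + 1)\<close>.
\<close>

definition alternating_sum :: "('a \<Rightarrow> real) \<Rightarrow> nat \<Rightarrow> real" where
  "alternating_sum u i = (\<Sum>j<i. (- 1) ^ j * u (H ! next_pos j))"

lemma alternating_sum_linear:
  "alternating_sum (\<lambda>x. u x + c * w x) i = alternating_sum u i + c * alternating_sum w i"
  by (simp add: alternating_sum_def sum.distrib sum_distrib_left algebra_simps)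

text \<open>
  The solution of the recursion along the \<open>Y i\<close> that starts with \<open>\<beta>\<close> at \<open>Y 0\<close>, with 0 on the \<open>X i\<close>
  so that the equations at the old vertices are those of \<open>G\<close>.
\<close>

fun lift :: "real \<Rightarrow> ('a \<Rightarrow> real) \<Rightarrow> 'a altan_vertex \<Rightarrow> real" where
  "lift \<beta> u (Old v) = u v"
| "lift \<beta> u (X i) = 0"
| "lift \<beta> u (Y i) = (- 1) ^ i * (\<beta> + alternating_sum u i)"

lemma lift_linear:
  "lift (\<beta> + c * \<gamma>) (\<lambda>x. u x + c * w x) = (\<lambda>p. lift \<beta> u p + c * lift \<gamma> w p)"
proof
  show "lift (\<beta> + c * \<gamma>) (\<lambda>x. u x + c * w x) p = lift \<beta> u p + c * lift \<gamma> w p" for p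
    by (cases p) (simp_all add: alternating_sum_linear algebra_simps)
qed

text \<open>
  The recursion holds by construction except at the step from \<open>Y (h - 1)\<close> back to \<open>Y 0\<close>, where it
  says that the formula for \<open>Y h\<close> must return the initial value \<open>\<beta>\<close>.
\<close>

lemma null_function_lift:
  assumes "null_function G u" and closing: "\<beta> = (- 1) ^ h * (\<beta> + alternating_sum u h)"
  shows "null_function G' (lift \<beta> u)"
proof -
  have "lift \<beta> u (Y (next_pos i)) = - lift \<beta> u (Y i) - u (H ! next_pos i)" if "i < h" for i
  proof -
    have step: "lift \<beta> u (Y (Suc i)) = - lift \<beta> u (Y i) - u (H ! next_pos i)"
    proof -
      have "(- 1) ^ i * ((- 1) ^ i * u (H ! next_pos i)) = u (H ! next_pos i)"
        by (simp add: power_mult_distrib[symmetric] mult.assoc[symmetric])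
      then show ?thesis
        by (simp add: alternating_sum_def algebra_simps)
    qed
    have "lift \<beta> u (Y h) = lift \<beta> u (Y 0)"
      using closing by (simp add: alternating_sum_def)
    then have "lift \<beta> u (Y (next_pos i)) = lift \<beta> u (Y (Suc i))"
      using that next_pos_last next_pos_Suc[of i] by (cases "Suc i = h") auto
    with step show ?thesis by (simp only:)
  qed
  then show ?thesis
    using assms(1) unfolding null_function_altan_iff
    by (simp add: null_function_def del: lift.simps(3))
qed

lemma alternating_on_cycle:
  fixes a :: "nat \<Rightarrow> real"
  assumes "\<forall>i<h. a (next_pos i) = - a i" and "i < h"
  shows "a i = (- 1) ^ i * a 0"
  using assms(2)
proof (induction i)
  case (Suc i)
  then show ?case using assms(1)[rule_format, of i] next_pos_Suc[of i] by simp
qed simp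

text \<open>
  One turn around the cycle multiplies the value by \<open>(- 1) ^ h = - 1\<close>.
\<close>

lemma alternating_on_odd_cycle:
  fixes a :: "nat \<Rightarrow> real"
  assumes "odd h" "\<forall>i<h. a (next_pos i) = - a i" "i < h"
  shows "a i = 0"
proof -
  have "a (h - 1) = (- 1) ^ (h - 1) * a 0"
    using alternating_on_cycle[OF assms(2), of "h - 1"] h_ge_2 by simp
  moreover have "a 0 = - a (h - 1)"
    using assms(2)[rule_format, of "h - 1"] h_ge_2 next_pos_last by simp
  ultimately have "a 0 = 0" using \<open>odd h\<close> by simp
  then show ?thesis using alternating_on_cycle[OF assms(2,3)] by simp
qed

lemma null_function_altan_X:
  assumes "null_function G' f"
  shows "\<forall>i<h. f (X (next_pos i)) = - f (X i)"
  using assms unfolding null_function_altan_iff by blast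

lemma null_function_altan_Y:
  assumes "null_function G' f"
  shows "\<forall>i<h. f (Y (next_pos i)) = - f (Y i) - f (Old (H ! next_pos i))"
  using assms unfolding null_function_altan_iff by blast

lemma null_function_restrict:
  assumes f: "null_function G' f" and "\<And>i. i < h \<Longrightarrow> f (X i) = 0"
  shows "null_function G (f \<circ> Old)"
  using assms unfolding null_function_altan_iff by (simp add: null_function_def)

text \<open>
  If \<open>f\<close> vanishes on the old vertices, the equations at the \<open>X i\<close> make it alternate on the \<open>Y i\<close>
  too, so that one zero on each of the two families is enough; for odd \<open>h\<close> these come for free.
\<close>

lemma altan_null_function_eq_0:
  assumes f: "null_function G' f"
    and Old: "\<And>v. v \<in> pverts G \<Longrightarrow> f (Old v) = 0"
    and X: "odd h \<or> f (X 0) = 0" and Y: "odd h \<or> f (Y 0) = 0"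
  shows "\<forall>p \<in> pverts G'. f p = 0"
proof -
  note alt = null_function_altan_X[OF f]
  have alt': "\<forall>i<h. f (Y (next_pos i)) = - f (Y i)"
    using null_function_altan_Y[OF f] Old[OF H_in[OF next_pos_less]] by simp
  have "f (X i) = 0" if "i < h" for i
    using X alternating_on_odd_cycle[of "\<lambda>i. f (X i)", OF _ alt that]
      alternating_on_cycle[of "\<lambda>i. f (X i)", OF alt that] by auto
  moreover have "f (Y i) = 0" if "i < h" for i
    using Y alternating_on_odd_cycle[of "\<lambda>i. f (Y i)", OF _ alt' that]
      alternating_on_cycle[of "\<lambda>i. f (Y i)", OF alt' that] by auto
  ultimately show ?thesis
    using Old by (auto simp: pverts_altan)
qed

section \<open>The nullity of the altan\<close>

lemma nullity_altan_le_if_odd: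
  assumes "odd h"
  shows "nullity G' \<le> nullity G"
proof -
  have "nullity G' \<le> nullity G + 0"
  proof (rule nullity_le_if_linear_inj[OF finite_pverts_altan finite_pverts])
    show "linear_op (\<lambda>f. f \<circ> Old)" "linear_op (\<lambda>_ _. 0)"
      by (simp_all add: linear_op_def comp_def)
    show "null_function G (f \<circ> Old)" if f: "null_function G' f" for f
      using f alternating_on_odd_cycle[OF assms null_function_altan_X[OF f]]
      by (rule null_function_restrict)
    show "\<forall>p \<in> pverts G'. f p = 0"
      if "null_function G' f" "\<forall>v \<in> pverts G. (f \<circ> Old) v = 0" for f
      using that assms by (intro altan_null_function_eq_0) auto
  qed
  then show ?thesis by simp
qed

text \<open>
  Restriction to the old vertices is sure to give a null function of \<open>G\<close> when \<open>f (X 0) = 0\<close>. Hence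
  \<open>f\<close> is replaced by \<open>T f\<close>, which has this property, and \<open>f (X 0)\<close> and \<open>f (Y 0)\<close> are recorded
  separately.
\<close>

lemma nullity_altan_le:
  "nullity G' \<le> nullity G + 2"
proof -
  obtain f\<^sub>0 where f\<^sub>0: "null_function G' f\<^sub>0"
    and t: "\<And>f. null_function G' f \<Longrightarrow> f (X 0) - f (X 0) / f\<^sub>0 (X 0) * f\<^sub>0 (X 0) = 0"
    using ex_correcting_null_function[of G' "\<lambda>f. f (X 0)"] by blast
  define T where "T f = (\<lambda>p. f p + - (f (X 0) / f\<^sub>0 (X 0)) * f\<^sub>0 p)" for f
  define l where "l f i = (if i = 0 then f (X 0) else f (Y 0))"
    for f :: "'a altan_vertex \<Rightarrow> real" and i :: nat
  show ?thesis
  proof (rule nullity_le_if_linear_inj[OF finite_pverts_altan finite_pverts])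
    show "linear_op (\<lambda>f. T f \<circ> Old)"
      by (simp add: linear_op_def T_def fun_eq_iff algebra_simps add_divide_distrib)
    show "linear_op l"
      by (simp add: linear_op_def l_def fun_eq_iff)
    show "null_function G (T f \<circ> Old)" if f: "null_function G' f" for f
    proof (rule null_function_restrict)
      show Tf: "null_function G' (T f)"
        unfolding T_def by (rule null_function_linear[OF f f\<^sub>0])
      have "T f (X 0) = 0"
        using t[OF f] by (simp add: T_def)
      then show "T f (X i) = 0" if "i < h" for i
        using alternating_on_cycle[OF null_function_altan_X[OF Tf] that] by simp
    qed
    show "\<forall>p \<in> pverts G'. f p = 0"
      if f: "null_function G' f" and Old: "\<forall>v \<in> pverts G. (T f \<circ> Old) v = 0"
        and l: "\<forall>i<2. l f i = 0" for f
    proof -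
      have 0: "f (X 0) = 0" "f (Y 0) = 0"
        using l[rule_format, of 0] l[rule_format, of 1] by (simp_all add: l_def)
      then have "T f = f" by (simp add: T_def)
      then show ?thesis using f Old 0 by (intro altan_null_function_eq_0) auto
    qed
  qed
qed

text \<open>
  For odd \<open>h\<close> every null function of \<open>G\<close> lifts. For even \<open>h\<close> only those with vanishing alternating
  sum do, so \<open>u\<close> is replaced by \<open>w u = u - t u * u\<^sub>0\<close>; the initial value at \<open>Y 0\<close>, which is free in
  this case, is used to store the coefficient \<open>t u\<close> that would otherwise be lost.
\<close>

lemma le_nullity_altan:
  "nullity G \<le> nullity G'"
proof -
  obtain u\<^sub>0 where u\<^sub>0: "null_function G u\<^sub>0" and
    t: "\<And>u. null_function G u \<Longrightarrow> alternating_sum u h -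
      alternating_sum u h / alternating_sum u\<^sub>0 h * alternating_sum u\<^sub>0 h = 0"
    using ex_correcting_null_function[of G "\<lambda>u. alternating_sum u h"] by blast
  define t where "t u = alternating_sum u h / alternating_sum u\<^sub>0 h" for u
  define w where "w u = (\<lambda>x. u x + - t u * u\<^sub>0 x)" for u
  define T where "T u = (if even h then lift (t u) (w u) else lift (- alternating_sum u h / 2) u)" for u
  have t_linear: "t (\<lambda>x. u x + c * u' x) = t u + c * t u'" for u c u'
    by (simp add: t_def alternating_sum_linear add_divide_distrib)
  have "nullity G \<le> nullity G' + 0"
  proof (rule nullity_le_if_linear_inj[OF finite_pverts finite_pverts_altan])
    have w_linear: "w (\<lambda>x. u x + c * u' x) = (\<lambda>x. w u x + c * w u' x)" for u c u'
      by (simp add: w_def t_linear algebra_simps)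
    have half: "- (a + c * b) / 2 = - a / 2 + c * (- b / 2)" for a b c :: real
      by (simp add: field_simps)
    show "linear_op T"
      unfolding linear_op_def T_def
      by (simp only: t_linear w_linear alternating_sum_linear half lift_linear split: if_split) simp
    show "linear_op (\<lambda>_ _. 0)"
      by (simp add: linear_op_def)
    show "null_function G' (T u)" if u: "null_function G u" for u
    proof (cases "even h")
      case True
      have "null_function G (w u)"
        unfolding w_def by (rule null_function_linear[OF u u\<^sub>0])
      moreover have "alternating_sum (w u) h = 0"
        using t[OF u] unfolding w_def alternating_sum_linear t_def by simp
      ultimately show ?thesis
        using True by (simp add: T_def null_function_lift)
    next
      case False
      then show ?thesis
        using u by (simp add: T_def null_function_lift)
    qed
    show "\<forall>x \<in> pverts G. u x = 0"
      if "null_function G u" and 0: "\<forall>p \<in> pverts G'. T u p = 0" for u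
    proof -
      have Old_0: "T u (Old x) = 0" if "x \<in> pverts G" for x
        using 0 that by (auto simp: pverts_altan)
      show ?thesis
      proof (cases "even h")
        case True
        (* the value of T u at Y 0 is t u, so the multiple that was subtracted can be read off *)
        have "T u (Y 0) = 0"
          using 0 h_ge_2 by (simp add: pverts_altan)
        then have "t u = 0"
          using True by (simp add: T_def alternating_sum_def)
        then have "T u (Old x) = u x" for x
          using True by (simp add: T_def w_def)
        then show ?thesis using Old_0 by simp
      next
        case False
        then have "T u (Old x) = u x" for x
          by (simp add: T_def)
        then show ?thesis using Old_0 by simp
      qed
    qed
  qed
  then show ?thesis by simp
qed

end

theorem corollary12:
  fixes G :: "'a pair_pre_digraph" and H :: "'a list"
  assumes "pair_graph G" and "attachment_set G H"
  shows "(even (length H) \<longrightarrow>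
            nullity G \<le> nullity (fst (altan G H)) \<and> nullity (fst (altan G H)) \<le> nullity G + 2) \<and>
         (odd (length H) \<longrightarrow> nullity (fst (altan G H)) = nullity G)"
proof -
  interpret altan_pair G H "length H" "fst (altan G H)"
    using assms by (rule altan_pair.intro)
  show ?thesis
    using le_nullity_altan nullity_altan_le nullity_altan_le_if_odd by auto
qed

end
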